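(* Let $n\ge 1$, $q\geq 2$, $d$ and $s$ be integers with $0\leq d\leq n(q-1)$ and $0\le s\leq \frac{n}{2}$. Let $\mathcal{V}\subseteq \{0,1,\ldots,q-1\}^n$ be a $d$-uniform tuple system such that $\mathcal{V}$ shatters no subset of $[n]$ of size $s+1$. Then $$|\mathcal{V}|\leq \sum_{i=0}^s (q-1)^{n-i}\left( {n \choose i}-{n \choose i-1}\right).$$
   Context: $[n]=\{1,\ldots,n\}$ and $(q)=\{0,1,\ldots,q-1\}$. A tuple system is a subset $\mathcal{V}\subseteq (q)^n$; a tuple $\mathbf v=(v_1,\ldots,v_n)$ is viewed as a function $[n]\to(q)$. $\mathcal{V}$ shatters $S\subseteq[n]$ if $\{\mathbf v|_S:\mathbf v\in\mathcal V\}$ is the set of all functions $S\to (q)$. $\mathcal V$ is $d$-uniform if $\sum_{i=1}^n v_i=d$ for every $(v_1,\ldots,v_n)\in\mathcal V$. Convention: ${n\choose -1}=0$. *)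

theory Defs
  imports Complex_Main "HOL-Library.FuncSet"
begin

text \<open>Tuples in \<open>(q)\<^sup>n\<close> are extensional functions from \<open>{1..n}\<close> to \<open>{0..<q}\<close>, so that
  distinct elements of a tuple system are distinct as tuples.\<close>

definition tuple_system :: "nat \<Rightarrow> nat \<Rightarrow> (nat \<Rightarrow> nat) set \<Rightarrow> bool" where
  "tuple_system n q V \<longleftrightarrow> V \<subseteq> {1..n} \<rightarrow>\<^sub>E {0..<q}"

definition shatters :: "nat \<Rightarrow> (nat \<Rightarrow> nat) set \<Rightarrow> nat set \<Rightarrow> bool" where
  "shatters q V S \<longleftrightarrow> (\<lambda>v. restrict v S) ` V = S \<rightarrow>\<^sub>E {0..<q}"

definition uniform_system :: "nat \<Rightarrow> nat \<Rightarrow> (nat \<Rightarrow> nat) set \<Rightarrow> bool" where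
  "uniform_system n d V \<longleftrightarrow> (\<forall>v\<in>V. (\<Sum>i=1..n. v i) = d)"

text \<open>Integer lower index, with the convention that the coefficient vanishes at \<open>-1\<close>.\<close>

definition binom :: "nat \<Rightarrow> int \<Rightarrow> int" where
  "binom n k = (if k < 0 then 0 else int (n choose nat k))"

end

theory Submission
  imports Defs "HOL-Library.Function_Algebras"
begin

text \<open>Write \<open>r = q - 1\<close>. A weight \<open>f\<close> on \<open>V\<close> has the moments
  \<open>(\<Sum>v\<in>V. f v * (\<Prod>j. v j choose w j))\<close>, and the level set of \<open>w\<close> consists of the coordinates with
  \<open>w j = r\<close>. By uniformity the moment of \<open>v \<in> V\<close> is \<open>f v\<close>, so \<open>f\<close> vanishes as soon as all its
  moments do. As \<open>V\<close> misses a pattern on every set of size \<open>s + 1\<close>, expanding the indicator of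
  that pattern in binomials reduces all moments to those with level set of size at most \<open>s\<close>.
  Multiplying by \<open>(\<Sum>j. v j) = d\<close> yields linear relations among moments with level sets of size
  \<open>i\<close> modulo smaller ones; they reduce everything further to level sets that are ballot sets, of
  which there are \<open>(n choose i) - (n choose (i - 1))\<close> of size \<open>i\<close>. Hence if \<open>V\<close> had more elements
  than there are such \<open>w\<close>, a nonzero \<open>f\<close> orthogonal to all of them would exist, a contradiction.\<close>

section \<open>Homogeneous linear systems\<close>

lemma (in vector_space) nontrivial_relation_if_card_gt:
  assumes "finite B" "finite V" "card B < card V" "c ` V \<subseteq> span B"
  obtains f where "\<exists>v\<in>V. f v \<noteq> 0" "(\<Sum>v\<in>V. f v *s c v) = 0"
proof (cases "inj_on c V")
  case True
  then have "dependent (c ` V)"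
    using independent_span_bound[OF assms(1) _ assms(4)] assms(3) by (auto simp: card_image)
  then obtain u where "\<exists>x\<in>c ` V. u x \<noteq> 0" "(\<Sum>x\<in>c ` V. u x *s x) = 0"
    using \<open>finite V\<close> by (auto simp: dependent_finite)
  then show ?thesis
    using that[of "u \<circ> c"] by (simp add: sum.reindex[OF True])
next
  case False
  then obtain v v' where v: "v \<in> V" "v' \<in> V" "v \<noteq> v'" "c v = c v'"
    by (auto simp: inj_on_def)
  define f where "f x = (of_bool (x = v) - of_bool (x = v') :: 'a)" for x
  have "(\<Sum>x\<in>V. f x *s c x) = (\<Sum>x\<in>{v, v'}. f x *s c x)"
    using v \<open>finite V\<close> by (intro sum.mono_neutral_right) (auto simp: f_def)
  also have "\<dots> = 0" using v(3,4) by (simp add: f_def)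
  finally have "(\<Sum>x\<in>V. f x *s c x) = 0" .
  moreover have "f v \<noteq> 0" using v(3) by (simp add: f_def)
  ultimately show ?thesis using v(1) that by blast
qed

lemma homogeneous_system_nontrivial_solution:
  fixes a :: "'m \<Rightarrow> 'v \<Rightarrow> 'k::field"
  assumes "finite M" "finite V" "card M < card V"
  shows "\<exists>f. (\<exists>v\<in>V. f v \<noteq> 0) \<and> (\<forall>m\<in>M. (\<Sum>v\<in>V. f v * a m v) = 0)"
proof -
  interpret vector_space "\<lambda>(c::'k) (g::'m \<Rightarrow> 'k) m. c * g m"
    by unfold_locales (auto simp: fun_eq_iff algebra_simps)
  have sum_apply: "sum F X m = (\<Sum>x\<in>X. F x m)" for F :: "'x \<Rightarrow> 'm \<Rightarrow> 'k" and X m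
    by (induction X rule: infinite_finite_induct) auto
  define column where "column v = (\<lambda>m. if m \<in> M then a m v else 0)" for v
  define unit where "unit m = (\<lambda>m'. of_bool (m' = m) :: 'k)" for m :: 'm
  have "column v = (\<Sum>m\<in>M. (\<lambda>m'. a m v * unit m m'))" for v
    using \<open>finite M\<close> by (auto simp: fun_eq_iff sum_apply column_def unit_def)
  then have "column ` V \<subseteq> span (unit ` M)"
    by (auto intro!: span_sum span_scale intro: span_base)
  moreover have "card (unit ` M) < card V"
    using card_image_le[OF \<open>finite M\<close>, of unit] assms(3) by simp
  ultimately obtain f where f: "\<exists>v\<in>V. f v \<noteq> 0" "(\<Sum>v\<in>V. (\<lambda>m. f v * column v m)) = 0"
    using nontrivial_relation_if_card_gt[of "unit ` M" V column] assms(1,2) by blast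
  have "(\<Sum>v\<in>V. f v * a m v) = 0" if "m \<in> M" for m
    using fun_cong[OF f(2), of m] that by (simp add: sum_apply column_def)
  then show ?thesis using f(1) by blast
qed

section \<open>Harmonic functions on the subsets of a finite set\<close>

definition intermediate_sets :: "nat \<Rightarrow> 'a set \<Rightarrow> 'a set \<Rightarrow> 'a set set" where
  "intermediate_sets i A C = {T. A \<subseteq> T \<and> T \<subseteq> C \<and> card T = i}"

lemma finite_intermediate_sets: "finite C \<Longrightarrow> finite (intermediate_sets i A C)"
  by (rule finite_subset[of _ "Pow C"]) (auto simp: intermediate_sets_def)

definition harmonic :: "nat \<Rightarrow> 'a set \<Rightarrow> ('a set \<Rightarrow> 'b::comm_monoid_add) \<Rightarrow> bool" where
  "harmonic i W g \<longleftrightarrow>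
    (\<forall>U\<subseteq>W. Suc (card U) = i \<longrightarrow> (\<Sum>j\<in>W - U. g (insert j U)) = 0)"

lemma harmonic_sum_intermediate_sets:
  fixes g :: "'a set \<Rightarrow> 'b::{semiring_char_0, semiring_1_no_zero_divisors}"
  assumes "finite W" "harmonic i W g" "card A < i"
  shows "sum g (intermediate_sets i A W) = 0"
proof -
  obtain i' where i: "i = Suc i'" using assms(3) by (cases i) auto
  have finite_if_intermediate: "finite T" if "T \<in> intermediate_sets k A W" for T k
    using that \<open>finite W\<close> by (auto simp: intermediate_sets_def intro: finite_subset)
  have "0 = (\<Sum>U\<in>intermediate_sets i' A W. \<Sum>j\<in>W - U. g (insert j U))"
    using assms(2) i
    by (intro sum.neutral[symmetric] ballI) (simp add: harmonic_def intermediate_sets_def)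
  also have "\<dots> = (\<Sum>(U, j)\<in>(SIGMA U:intermediate_sets i' A W. W - U). g (insert j U))"
    using \<open>finite W\<close> by (simp add: sum.Sigma finite_intermediate_sets)
  also have "\<dots> = (\<Sum>(T, j)\<in>(SIGMA T:intermediate_sets i A W. T - A). g T)"
    by (rule sum.reindex_bij_witness[where i = "\<lambda>(T, j). (T - {j}, j)"
            and j = "\<lambda>(U, j). (insert j U, j)"])
      (auto simp: i insert_absorb card_insert_if intermediate_sets_def
        dest: finite_subset[OF _ \<open>finite W\<close>])
  also have "\<dots> = (\<Sum>T\<in>intermediate_sets i A W. \<Sum>j\<in>T - A. g T)"
    using \<open>finite W\<close> finite_if_intermediate
    by (subst sum.Sigma) (auto simp: finite_intermediate_sets)
  also have "\<dots> = (\<Sum>T\<in>intermediate_sets i A W. of_nat (i - card A) * g T)"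
  proof (intro sum.cong refl)
    fix T assume T: "T \<in> intermediate_sets i A W"
    then have "A \<subseteq> T" "card T = i" by (auto simp: intermediate_sets_def)
    then have "card (T - A) = i - card A"
      using finite_if_intermediate[OF T] finite_subset[of A T] by (simp add: card_Diff_subset)
    then show "(\<Sum>j\<in>T - A. g T) = of_nat (i - card A) * g T" by simp
  qed
  finally have "of_nat (i - card A) * sum g (intermediate_sets i A W) = 0"
    by (simp add: sum_distrib_left)
  then show ?thesis using assms(3) by (simp del: of_nat_diff)
qed

lemma harmonic_sum_intermediate_sets_avoiding:
  fixes g :: "'a set \<Rightarrow> 'b::{semiring_char_0, semiring_1_no_zero_divisors}"
  assumes "finite W" "harmonic i W g" "finite B" "card A + card B < i"
  shows "sum g (intermediate_sets i A (W - B)) = 0"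
  using assms(3,4)
proof (induction B arbitrary: A rule: finite_induct)
  case empty
  then show ?case using harmonic_sum_intermediate_sets[OF assms(1,2)] by simp
next
  case (insert b B)
  have "card (insert b A) \<le> Suc (card A)" by (rule card_insert_le_m1) auto
  then have sums_eq_0: "sum g (intermediate_sets i A (W - B)) = 0"
      "sum g (intermediate_sets i (insert b A) (W - B)) = 0"
    using insert.prems insert.hyps by (auto intro!: insert.IH)
  let ?without = "intermediate_sets i A (W - insert b B)"
  let ?with = "intermediate_sets i (insert b A) (W - B)"
  have "intermediate_sets i A (W - B) = ?without \<union> ?with" "?without \<inter> ?with = {}"
    by (auto simp: intermediate_sets_def)
  then have "sum g (intermediate_sets i A (W - B)) = sum g ?without + sum g ?with"
    using assms(1) by (simp add: sum.union_disjoint finite_intermediate_sets)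
  then show ?case using sums_eq_0 by simp
qed

section \<open>Ballot sets\<close>

definition ballot :: "nat \<Rightarrow> nat set \<Rightarrow> bool" where
  "ballot n T \<longleftrightarrow> T \<subseteq> {1..n} \<and> (\<forall>k\<le>n. 2 * card (T \<inter> {1..k}) \<le> k)"

lemma sum_less_sum_if_moved_beyond:
  fixes T T' :: "nat set"
  assumes "finite T" "finite T'" "card T = card T'" "T \<noteq> T'"
    and below: "T - T' \<subseteq> {..k}" and beyond: "T' - T \<subseteq> {k<..}"
  shows "\<Sum>T < \<Sum>T'"
proof -
  have card_eq: "card (T - T') = card (T' - T)"
    using assms(1-3) card_Int_Diff[of T T'] card_Int_Diff[of T' T] by (simp add: Int_commute)
  have "T' - T \<noteq> {}"
    using card_subset_eq[OF assms(1), of T'] assms(3,4) by auto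
  then have "card (T' - T) > 0"
    using assms(2) by (simp add: card_gt_0_iff)
  have "\<Sum>(T - T') \<le> card (T - T') * k"
    using sum_bounded_above[of "T - T'" "\<lambda>j. j" k] below by auto
  also have "\<dots> < card (T' - T) * Suc k"
    using card_eq \<open>card (T' - T) > 0\<close> by simp
  also have "\<dots> \<le> \<Sum>(T' - T)"
    using sum_bounded_below[of "T' - T" "Suc k" "\<lambda>j. j"] beyond by (auto simp: Suc_le_eq)
  finally have "\<Sum>(T - T') < \<Sum>(T' - T)" .
  moreover have "\<Sum>T = \<Sum>(T \<inter> T') + \<Sum>(T - T')" "\<Sum>T' = \<Sum>(T \<inter> T') + \<Sum>(T' - T)"
    using sum.Int_Diff[OF assms(1), of _ T'] sum.Int_Diff[OF assms(2), of _ T]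
    by (simp_all add: Int_commute)
  ultimately show ?thesis by simp
qed

lemma harmonic_sum_fixed_beyond_prefix:
  fixes g :: "nat set \<Rightarrow> 'b::{semiring_char_0, semiring_1_no_zero_divisors}"
  assumes "finite W" "harmonic (card T) W g" "finite T" "k < 2 * card (T \<inter> {1..k})"
  shows "sum g (intermediate_sets (card T) (T - {1..k}) (W - ({1..k} - T))) = 0"
proof (rule harmonic_sum_intermediate_sets_avoiding[OF assms(1,2)])
  have "card ({1..k} - T) + card (T \<inter> {1..k}) = k"
    using card_Int_Diff[of "{1..k}" T] by (simp add: Int_commute)
  moreover have "card (T - {1..k}) + card (T \<inter> {1..k}) = card T"
    using card_Int_Diff[OF assms(3), of "{1..k}"] by simp
  ultimately show "card (T - {1..k}) + card ({1..k} - T) < card T"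
    using assms(4) by linarith
qed simp

text \<open>Straightening: if \<open>T\<close> is not a ballot set because of the prefix \<open>{1..k}\<close>, then \<open>g\<close> sums to
  \<open>0\<close> over the sets that avoid \<open>{1..k} - T\<close> and contain \<open>T - {1..k}\<close>, and every such set other
  than \<open>T\<close> arises from \<open>T\<close> by moving elements beyond \<open>k\<close>.\<close>

lemma harmonic_eq_0_if_ballot_eq_0:
  fixes g :: "nat set \<Rightarrow> 'b::{semiring_char_0, semiring_1_no_zero_divisors}"
  assumes "W \<subseteq> {1..n}" "harmonic i W g"
    and ballot: "\<And>T. T \<subseteq> W \<Longrightarrow> card T = i \<Longrightarrow> ballot n T \<Longrightarrow> g T = 0"
    and "T \<subseteq> W" "card T = i"
  shows "g T = 0"
  using assms(4,5)
proof (induction T rule: measure_induct_rule[where f = "\<lambda>T. \<Sum>{1..n} - \<Sum>T"])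
  case (less T)
  have "finite W" using assms(1) finite_subset by blast
  then have finite_if_subset: "finite U" if "U \<subseteq> W" for U using that finite_subset by blast
  show ?case
  proof (cases "ballot n T")
    case True
    then show ?thesis using ballot less.prems by simp
  next
    case False
    then obtain k where k: "k < 2 * card (T \<inter> {1..k})"
      using less.prems assms(1) by (auto simp: ballot_def not_le)
    define S where "S = intermediate_sets i (T - {1..k}) (W - ({1..k} - T))"
    have "sum g S = 0"
      using harmonic_sum_fixed_beyond_prefix[OF \<open>finite W\<close> _ _ k, of g] assms(2)
        less.prems finite_if_subset
      by (simp add: S_def)
    moreover have "g T' = 0" if "T' \<in> S - {T}" for T'
    proof (rule less.IH)
      show T': "T' \<subseteq> W" "card T' = i" using that by (auto simp: S_def intermediate_sets_def)
      have "T - T' \<subseteq> {..k}" "T' - T \<subseteq> {k<..}"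
        using that assms(1) by (fastforce simp: S_def intermediate_sets_def)+
      then have "\<Sum>T < \<Sum>T'"
        using that T' less.prems finite_if_subset by (intro sum_less_sum_if_moved_beyond) auto
      moreover have "\<Sum>T' \<le> \<Sum>{1..n}"
        using T' assms(1) by (intro sum_mono2) auto
      ultimately show "\<Sum>{1..n} - \<Sum>T' < \<Sum>{1..n} - \<Sum>T" by linarith
    qed
    moreover have "T \<in> S" using less.prems by (auto simp: S_def intermediate_sets_def)
    moreover have "finite S" using \<open>finite W\<close> by (simp add: S_def finite_intermediate_sets)
    ultimately show ?thesis by (simp add: sum.remove)
  qed
qed

lemma ballot_Suc_iff:
  assumes "T \<subseteq> {1..Suc n}"
  shows "ballot (Suc n) T \<longleftrightarrow> ballot n (T \<inter> {1..n}) \<and> 2 * card T \<le> Suc n"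
proof -
  have "T \<inter> {1..Suc n} = T" using assms by auto
  moreover have "T \<inter> {1..n} \<inter> {1..k} = T \<inter> {1..k}" if "k \<le> n" for k
    using that by auto
  ultimately show ?thesis using assms by (auto simp: ballot_def le_Suc_eq)
qed

definition ballot_sets :: "nat \<Rightarrow> nat \<Rightarrow> nat set set" where
  "ballot_sets n i = {T. ballot n T \<and> card T = i}"

lemma finite_ballot_sets: "finite (ballot_sets n i)"
  by (rule finite_subset[of _ "Pow {1..n}"]) (auto simp: ballot_sets_def ballot_def)

lemma ballot_sets_0: "ballot_sets n 0 = {{}}"
  by (auto simp: ballot_sets_def ballot_def dest: finite_subset)

lemma ballot_sets_eq_empty: "n < 2 * i \<Longrightarrow> ballot_sets n i = {}"
  by (auto simp: ballot_sets_def ballot_def Int_absorb2)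

lemma ballot_sets_Suc_Suc:
  assumes "2 * Suc i \<le> Suc n"
  shows "ballot_sets (Suc n) (Suc i) = ballot_sets n (Suc i) \<union> insert (Suc n) ` ballot_sets n i"
proof (intro equalityI subsetI)
  fix T assume "T \<in> ballot_sets (Suc n) (Suc i)"
  then have T: "T \<subseteq> {1..Suc n}" "ballot n (T \<inter> {1..n})" "card T = Suc i"
    using ballot_Suc_iff[of T n] by (auto simp: ballot_sets_def ballot_def)
  show "T \<in> ballot_sets n (Suc i) \<union> insert (Suc n) ` ballot_sets n i"
  proof (cases "Suc n \<in> T")
    case True
    then have insert_eq: "T = insert (Suc n) (T \<inter> {1..n})" using T by (auto simp: le_Suc_eq)
    have "card T = Suc (card (T \<inter> {1..n}))" using arg_cong[OF insert_eq, of card] by simp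
    then have "T \<inter> {1..n} \<in> ballot_sets n i" using T by (simp add: ballot_sets_def)
    then show ?thesis using insert_eq by blast
  next
    case False
    then have "T \<inter> {1..n} = T" using T by (fastforce simp: le_Suc_eq)
    then show ?thesis using T by (simp add: ballot_sets_def)
  qed
next
  fix T assume "T \<in> ballot_sets n (Suc i) \<union> insert (Suc n) ` ballot_sets n i"
  then consider (without_last) "T \<in> ballot_sets n (Suc i)"
    | (with_last) U where "T = insert (Suc n) U" "U \<in> ballot_sets n i" by blast
  then show "T \<in> ballot_sets (Suc n) (Suc i)"
  proof cases
    case without_last
    then have "T \<subseteq> {1..n}" "T \<inter> {1..n} = T" by (auto simp: ballot_sets_def ballot_def)
    then show ?thesis using without_last assms ballot_Suc_iff[of T n]
      by (force simp: ballot_sets_def)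
  next
    case with_last
    then have U: "U \<subseteq> {1..n}" "ballot n U" "card U = i" by (auto simp: ballot_sets_def ballot_def)
    then have "T \<inter> {1..n} = U" "T \<subseteq> {1..Suc n}" "card T = Suc i"
      using with_last finite_subset[OF U(1)] by (auto simp: card_insert_if)
    then show ?thesis using U assms by (simp add: ballot_sets_def ballot_Suc_iff)
  qed
qed

lemma card_ballot_sets_Suc_Suc:
  assumes "2 * Suc i \<le> Suc n"
  shows "card (ballot_sets (Suc n) (Suc i)) = card (ballot_sets n (Suc i)) + card (ballot_sets n i)"
proof -
  have fresh: "Suc n \<notin> T" if "T \<in> ballot_sets n k" for T k
    using that by (auto simp: ballot_sets_def ballot_def)
  then have "ballot_sets n (Suc i) \<inter> insert (Suc n) ` ballot_sets n i = {}" by blast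
  moreover have "inj_on (insert (Suc n)) (ballot_sets n i)"
    by (rule inj_onI) (simp add: insert_ident fresh)
  ultimately show ?thesis
    by (simp add: ballot_sets_Suc_Suc[OF assms] card_Un_disjoint card_image finite_ballot_sets)
qed

lemma binom_Suc: "binom (Suc n) (int i) = binom n (int i) + binom n (int i - 1)"
  by (cases i) (auto simp: binom_def nat_add_distrib)

lemma card_ballot_sets:
  assumes "2 * i \<le> Suc n"
  shows "int (card (ballot_sets n i)) = binom n (int i) - binom n (int i - 1)"
  using assms
proof (induction n arbitrary: i)
  case 0
  then have "i = 0" by simp
  then show ?case by (simp add: ballot_sets_0 binom_def)
next
  case (Suc n)
  consider (zero) "i = 0" | (step) i' where "i = Suc i'" "2 * i \<le> Suc n"
    | (middle) i' where "i = Suc i'" "Suc n = i' + i"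
    using Suc.prems by (cases i) force+
  then show ?case
  proof cases
    case zero
    then show ?thesis by (simp add: ballot_sets_0 binom_def)
  next
    case step
    then have "int (card (ballot_sets (Suc n) i))
        = int (card (ballot_sets n i)) + int (card (ballot_sets n i'))"
      using card_ballot_sets_Suc_Suc[of i' n] by simp
    also have "\<dots> = (binom n (int i) - binom n (int i - 1))
        + (binom n (int i') - binom n (int i' - 1))"
      using Suc.IH[of i] Suc.IH[of i'] step by simp
    also have "\<dots> = binom (Suc n) (int i) - binom (Suc n) (int i - 1)"
      using binom_Suc[of n i] binom_Suc[of n i'] step(1) by simp
    finally show ?thesis .
  next
    case middle
    then have "binom (Suc n) (int i) = binom (Suc n) (int i - 1)"
      using binomial_symmetric[of i "i' + i"] by (simp add: binom_def nat_add_distrib)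
    moreover have "ballot_sets (Suc n) i = {}"
      using middle by (intro ballot_sets_eq_empty) simp
    ultimately show ?thesis by simp
  qed
qed

section \<open>Binomial moments\<close>

definition binomial_prod :: "'a set \<Rightarrow> ('a \<Rightarrow> nat) \<Rightarrow> ('a \<Rightarrow> nat) \<Rightarrow> nat" where
  "binomial_prod I v w = (\<Prod>j\<in>I. v j choose w j)"

definition moment ::
  "'a set \<Rightarrow> ('a \<Rightarrow> nat) set \<Rightarrow> (('a \<Rightarrow> nat) \<Rightarrow> 'k::semiring_1) \<Rightarrow> ('a \<Rightarrow> nat) \<Rightarrow> 'k" where
  "moment I V f w = (\<Sum>v\<in>V. f v * of_nat (binomial_prod I v w))"

definition level :: "'a set \<Rightarrow> nat \<Rightarrow> ('a \<Rightarrow> nat) \<Rightarrow> 'a set" where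
  "level I r w = {j\<in>I. w j = r}"

lemma moment_restrict: "moment I V f (restrict w I) = moment I V f w"
  by (simp add: moment_def binomial_prod_def)

lemma binomial_prod_eq_0: "finite I \<Longrightarrow> j \<in> I \<Longrightarrow> v j < w j \<Longrightarrow> binomial_prod I v w = 0"
  by (auto simp: binomial_prod_def)

lemma binomial_prod_eq_of_bool:
  assumes "finite I" "v \<in> extensional I" "w \<in> extensional I" "sum v I = sum w I"
  shows "binomial_prod I v w = of_bool (v = w)"
proof (cases "\<exists>j\<in>I. v j < w j")
  case True
  then show ?thesis using binomial_prod_eq_0[OF assms(1)] by auto
next
  case False
  then have "v j = w j" if "j \<in> I" for j
    using that assms(1,4) sum_mono_inv[of w I v j] by (auto simp: not_less)
  then have "v = w" using assms(2,3) by (intro extensionalityI)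
  then show ?thesis by (simp add: binomial_prod_def)
qed

lemma moment_self:
  assumes "finite I" "finite V" "V \<subseteq> extensional I" "\<And>v. v \<in> V \<Longrightarrow> sum v I = d" "w \<in> V"
  shows "moment I V f w = f w"
proof -
  have "moment I V f w = (\<Sum>v\<in>V. f v * of_bool (v = w))"
    unfolding moment_def
  proof (intro sum.cong refl)
    fix v assume "v \<in> V"
    then have "binomial_prod I v w = of_bool (v = w)"
      using assms by (intro binomial_prod_eq_of_bool) auto
    then show "f v * of_nat (binomial_prod I v w) = f v * of_bool (v = w)" by simp
  qed
  then show ?thesis using assms(2,5) by simp
qed

lemma moment_eq_0_if_exceeds:
  assumes "finite I" "V \<subseteq> I \<rightarrow>\<^sub>E {..r}" "j \<in> I" "r < w j"
  shows "moment I V f w = 0"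
  unfolding moment_def
proof (intro sum.neutral ballI)
  fix v assume "v \<in> V"
  then have "v j \<in> {..r}" using assms(2,3) PiE_mem by blast
  then have "v j < w j" using assms(4) by simp
  then show "f v * of_nat (binomial_prod I v w) = 0"
    using assms(1,3) by (simp add: binomial_prod_eq_0)
qed

lemma times_binomial: "x * (x choose k) = k * (x choose k) + Suc k * (x choose Suc k)"
proof -
  have "real (x * (x choose k)) = real (k * (x choose k) + Suc k * (x choose Suc k))"
    using gbinomial_mult_1[of "real x" k] by (simp add: distrib_right flip: binomial_gbinomial)
  then show ?thesis by (simp only: of_nat_eq_iff)
qed

lemma times_binomial_prod:
  assumes "finite I" "j \<in> I"
  shows "v j * binomial_prod I v w
    = w j * binomial_prod I v w + Suc (w j) * binomial_prod I v (w(j := Suc (w j)))"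
proof -
  let ?rest = "\<Prod>k\<in>I - {j}. v k choose w k"
  have w: "binomial_prod I v w = (v j choose w j) * ?rest"
    using assms by (simp add: binomial_prod_def prod.remove)
  have "(\<Prod>k\<in>I - {j}. v k choose (w(j := Suc (w j))) k) = ?rest"
    by (intro prod.cong) auto
  then have upd: "binomial_prod I v (w(j := Suc (w j))) = (v j choose Suc (w j)) * ?rest"
    using assms by (simp add: binomial_prod_def prod.remove)
  have "v j * binomial_prod I v w = (v j * (v j choose w j)) * ?rest"
    by (simp add: w)
  then show ?thesis unfolding w upd times_binomial by (simp add: algebra_simps)
qed

lemma of_nat_times_moment:
  fixes f :: "('a \<Rightarrow> nat) \<Rightarrow> 'k::comm_semiring_1"
  assumes "finite I" "\<And>v. v \<in> V \<Longrightarrow> sum v I = d"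
  shows "of_nat d * moment I V f w = (\<Sum>j\<in>I. of_nat (w j) * moment I V f w
    + of_nat (Suc (w j)) * moment I V f (w(j := Suc (w j))))"
proof -
  let ?prod = "\<lambda>v w. of_nat (binomial_prod I v w) :: 'k"
  have times_term: "of_nat (v j) * ?prod v w
      = of_nat (w j) * ?prod v w + of_nat (Suc (w j)) * ?prod v (w(j := Suc (w j)))"
    if "j \<in> I" for v j
    using times_binomial_prod[OF assms(1) that] by (simp only: flip: of_nat_mult of_nat_add)
  have "of_nat d * moment I V f w = (\<Sum>v\<in>V. f v * (of_nat (\<Sum>j\<in>I. v j) * ?prod v w))"
    unfolding moment_def sum_distrib_left using assms(2)
    by (intro sum.cong) (auto simp: mult.left_commute)
  also have "\<dots> = (\<Sum>v\<in>V. \<Sum>j\<in>I. f v * (of_nat (v j) * ?prod v w))"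
    by (simp add: sum_distrib_left sum_distrib_right)
  also have "\<dots> = (\<Sum>j\<in>I. \<Sum>v\<in>V. f v * (of_nat (v j) * ?prod v w))" by (rule sum.swap)
  also have "\<dots> = (\<Sum>j\<in>I. \<Sum>v\<in>V. of_nat (w j) * (f v * ?prod v w)
      + of_nat (Suc (w j)) * (f v * ?prod v (w(j := Suc (w j)))))"
    by (intro sum.cong refl) (simp only: times_term distrib_left mult.left_commute)
  also have "\<dots> = (\<Sum>j\<in>I. of_nat (w j) * moment I V f w
    + of_nat (Suc (w j)) * moment I V f (w(j := Suc (w j))))"
    unfolding moment_def by (simp only: sum.distrib sum_distrib_left)
  finally show ?thesis .
qed

section \<open>Reduction to ballot level sets\<close>

lemma level_override_on_const:
  assumes "level I r b = {}" "T \<subseteq> I"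
  shows "level I r (override_on b (\<lambda>_. r) T) = T"
  using assms by (auto simp: level_def override_on_def)

lemma harmonic_moment_override_on:
  fixes f :: "('a \<Rightarrow> nat) \<Rightarrow> 'k::{idom, ring_char_0}"
  assumes "finite I" "\<And>v. v \<in> V \<Longrightarrow> sum v I = d" "r \<ge> 1"
    and level_b: "level I r b = {}"
    and smaller: "\<And>w. card (level I r w) < i \<Longrightarrow> moment I V f w = 0"
  shows "harmonic i (level I (r - 1) b) (\<lambda>T. moment I V f (override_on b (\<lambda>_. r) T))"
  unfolding harmonic_def
proof (intro allI impI)
  let ?x = "override_on b (\<lambda>_. r)"
  define W where "W = level I (r - 1) b"
  fix U assume "U \<subseteq> level I (r - 1) b" and U: "Suc (card U) = i"
  then have "U \<subseteq> I" by (auto simp: level_def)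
  then have "finite U" using assms(1) finite_subset by blast
  define x' where "x' j = (?x U)(j := Suc (?x U j))" for j
  have "moment I V f (?x U) = 0"
    using U by (intro smaller) (simp add: level_override_on_const level_b \<open>U \<subseteq> I\<close>)
  then have "0 = (\<Sum>j\<in>I. of_nat (Suc (?x U j)) * moment I V f (x' j))"
    using of_nat_times_moment[OF assms(1), of V d f "?x U"] assms(2)
    by (simp add: x'_def del: of_nat_Suc)
  also have "\<dots> = (\<Sum>j\<in>W - U. of_nat r * moment I V f (?x (insert j U)))"
  proof (intro sum.mono_neutral_cong_right assms(1) ballI)
    show "W - U \<subseteq> I" by (auto simp: W_def level_def)
    fix j assume "j \<in> I - (W - U)"
    then have "level I r (x' j) \<subseteq> U"
      using level_b by (auto simp: x'_def W_def level_def override_on_def split: if_splits)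
    then have "card (level I r (x' j)) < i"
      using card_mono[OF \<open>finite U\<close>, of "level I r (x' j)"] U by simp
    then have "moment I V f (x' j) = 0" by (rule smaller)
    then show "of_nat (Suc (?x U j)) * moment I V f (x' j) = 0" by simp
  next
    fix j assume "j \<in> W - U"
    then have "Suc (?x U j) = r" "x' j = ?x (insert j U)"
      using assms(3) by (auto simp: x'_def W_def level_def override_on_insert)
    then show "of_nat (Suc (?x U j)) * moment I V f (x' j)
        = of_nat r * moment I V f (?x (insert j U))"
      by simp
  qed
  finally show "(\<Sum>j\<in>level I (r - 1) b - U. moment I V f (?x (insert j U))) = 0"
    using assms(3) by (simp add: W_def flip: sum_distrib_left)
qed

lemma moment_eq_0_if_ballot_moments_eq_0:
  fixes f :: "(nat \<Rightarrow> nat) \<Rightarrow> 'k::{idom, ring_char_0}"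
  assumes "\<And>v. v \<in> V \<Longrightarrow> sum v {1..n} = d" "r \<ge> 1"
    and ballot: "\<And>w. card (level {1..n} r w) \<le> s \<Longrightarrow> ballot n (level {1..n} r w) \<Longrightarrow>
      moment {1..n} V f w = 0"
    and "card (level {1..n} r w) \<le> s"
  shows "moment {1..n} V f w = 0"
  using assms(4)
proof (induction "card (level {1..n} r w)" arbitrary: w rule: less_induct)
  case less
  define T where "T = level {1..n} r w"
  define b where "b = override_on w (\<lambda>_. r - 1) T"
  let ?x = "override_on b (\<lambda>_. r)"
  have level_b: "level {1..n} r b = {}"
    using assms(2) by (auto simp: b_def T_def level_def override_on_def)
  have "harmonic (card T) (level {1..n} (r - 1) b) (\<lambda>U. moment {1..n} V f (?x U))"
    using less assms(1,2) level_b by (intro harmonic_moment_override_on) (auto simp: T_def)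
  then have "moment {1..n} V f (?x T) = 0"
  proof (rule harmonic_eq_0_if_ballot_eq_0[rotated])
    fix U assume "U \<subseteq> level {1..n} (r - 1) b" "card U = card T" "ballot n U"
    moreover from this have "level {1..n} r (?x U) = U"
      by (intro level_override_on_const level_b) (auto simp: level_def)
    ultimately show "moment {1..n} V f (?x U) = 0"
      using less.prems by (intro ballot) (simp_all add: T_def)
  qed (auto simp: level_def b_def T_def)
  moreover have "?x T = w"
    by (auto simp: b_def T_def level_def override_on_def)
  ultimately show ?case by simp
qed

section \<open>Reduction to small level sets\<close>

text \<open>The coefficient of \<open>x choose k\<close> in the expansion of the indicator of \<open>x = a\<close>, by binomial
  inversion.\<close>

definition indicator_coeff :: "nat \<Rightarrow> nat \<Rightarrow> 'k::comm_ring_1" where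
  "indicator_coeff a k = (-1) ^ (k + a) * of_nat (k choose a)"

lemma indicator_coeff_eq_0_iff:
  "(indicator_coeff a k :: 'k::{idom, ring_char_0}) = 0 \<longleftrightarrow> k < a"
  by (simp add: indicator_coeff_def)

lemma sum_indicator_coeff:
  assumes "x \<le> r"
  shows "(\<Sum>k\<le>r. indicator_coeff a k * of_nat (x choose k)) = (of_bool (x = a) :: 'k::comm_ring_1)"
proof (cases "a \<le> x")
  case False
  then have "indicator_coeff a k * of_nat (x choose k) = (0 :: 'k)" for k
    by (cases "k < a") (auto simp: indicator_coeff_def binomial_eq_0)
  then show ?thesis using False by (simp add: not_le)
next
  case True
  have "(\<Sum>k\<le>r. indicator_coeff a k * of_nat (x choose k))
      = (\<Sum>k=a..x. indicator_coeff a k * of_nat (x choose k) :: 'k)"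
    using assms
    by (intro sum.mono_neutral_right) (auto simp: not_le indicator_coeff_def binomial_eq_0)
  also have "\<dots> = (\<Sum>k=a..x. of_nat (x choose a) * ((-1) ^ (k - a) * of_nat (x - a choose (k - a))))"
  proof (intro sum.cong refl)
    fix k assume k: "k \<in> {a..x}"
    then have "of_nat (k choose a) * of_nat (x choose k)
        = (of_nat (x choose a) * of_nat (x - a choose (k - a)) :: 'k)"
      using choose_mult[of a k x] by (simp add: mult.commute flip: of_nat_mult)
    moreover have "(-1) ^ (k + a) = ((-1) ^ (k - a) :: 'k)"
      using k by (simp add: uminus_power_if)
    ultimately show "indicator_coeff a k * of_nat (x choose k)
        = (of_nat (x choose a) * ((-1) ^ (k - a) * of_nat (x - a choose (k - a))) :: 'k)"
      by (simp add: indicator_coeff_def mult.assoc mult.left_commute)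
  qed
  also have "\<dots> = (\<Sum>k\<le>x - a. of_nat (x choose a) * ((-1) ^ k * of_nat (x - a choose k)))"
    using True by (intro sum.reindex_bij_witness[of _ "\<lambda>k. k + a" "\<lambda>k. k - a"]) auto
  also have "\<dots> = of_nat (x choose a) * (\<Sum>k\<le>x - a. (-1) ^ k * of_nat (x - a choose k))"
    by (simp add: sum_distrib_left)
  also have "\<dots> = of_bool (x = a)"
    using True choose_alternating_sum[of "x - a", where 'a = 'k] by (cases "x = a") auto
  finally show ?thesis .
qed

lemma sum_indicator_coeff_binomial_prod:
  assumes "finite S" "\<And>j. j \<in> S \<Longrightarrow> v j \<le> r"
  shows "(\<Sum>h\<in>S \<rightarrow>\<^sub>E {..r}. (\<Prod>j\<in>S. indicator_coeff (a j) (h j)) * of_nat (binomial_prod S v h))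
    = (of_bool (\<forall>j\<in>S. v j = a j) :: 'k::comm_ring_1)"
proof -
  have "(\<Sum>h\<in>S \<rightarrow>\<^sub>E {..r}. (\<Prod>j\<in>S. indicator_coeff (a j) (h j)) * of_nat (binomial_prod S v h))
      = (\<Sum>h\<in>S \<rightarrow>\<^sub>E {..r}. \<Prod>j\<in>S. indicator_coeff (a j) (h j) * of_nat (v j choose h j) :: 'k)"
    by (simp add: binomial_prod_def prod.distrib)
  also have "\<dots> = (\<Prod>j\<in>S. \<Sum>k\<le>r. indicator_coeff (a j) k * of_nat (v j choose k))"
    using assms(1) by (subst prod_sum_PiE) auto
  also have "\<dots> = (\<Prod>j\<in>S. of_bool (v j = a j))"
    using assms(2) by (intro prod.cong refl sum_indicator_coeff)
  also have "\<dots> = of_bool (\<forall>j\<in>S. v j = a j)"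
    using assms(1) by (induction S rule: finite_induct) auto
  finally show ?thesis .
qed

lemma binomial_prod_override_on:
  assumes "finite I" "S \<subseteq> I"
  shows "binomial_prod I v (override_on w h S) = binomial_prod S v h * binomial_prod (I - S) v w"
proof -
  have "binomial_prod I v (override_on w h S)
      = binomial_prod (I - S) v (override_on w h S) * binomial_prod S v (override_on w h S)"
    unfolding binomial_prod_def using assms by (rule prod.subset_diff[rotated])
  also have "\<dots> = binomial_prod (I - S) v w * binomial_prod S v h"
    by (simp add: binomial_prod_def)
  finally show ?thesis by (simp add: mult.commute)
qed

lemma sum_indicator_coeff_moment_eq_0:
  fixes f :: "('a \<Rightarrow> nat) \<Rightarrow> 'k::comm_ring_1"
  assumes "finite I" "V \<subseteq> I \<rightarrow>\<^sub>E {..r}" "S \<subseteq> I"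
    and missing: "\<And>v. v \<in> V \<Longrightarrow> \<exists>j\<in>S. v j \<noteq> a j"
  shows "(\<Sum>h\<in>S \<rightarrow>\<^sub>E {..r}. (\<Prod>j\<in>S. indicator_coeff (a j) (h j))
    * moment I V f (override_on w h S)) = 0"
proof -
  let ?c = "\<lambda>h. \<Prod>j\<in>S. indicator_coeff (a j) (h j) :: 'k"
  have "finite S" using assms(1,3) finite_subset by blast
  have vanish: "(\<Sum>h\<in>S \<rightarrow>\<^sub>E {..r}. ?c h * of_nat (binomial_prod I v (override_on w h S))) = 0"
    if "v \<in> V" for v
  proof -
    have "(\<Sum>h\<in>S \<rightarrow>\<^sub>E {..r}. ?c h * of_nat (binomial_prod I v (override_on w h S)))
        = (\<Sum>h\<in>S \<rightarrow>\<^sub>E {..r}. ?c h * of_nat (binomial_prod S v h))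
          * of_nat (binomial_prod (I - S) v w)"
      using assms(1,3) by (simp add: binomial_prod_override_on sum_distrib_right mult.assoc)
    also have "(\<Sum>h\<in>S \<rightarrow>\<^sub>E {..r}. ?c h * of_nat (binomial_prod S v h)) = of_bool (\<forall>j\<in>S. v j = a j)"
      using that assms(2,3) by (intro sum_indicator_coeff_binomial_prod \<open>finite S\<close>) fastforce
    also have "\<dots> = 0" using missing[OF that] by simp
    finally show ?thesis by simp
  qed
  have "(\<Sum>h\<in>S \<rightarrow>\<^sub>E {..r}. ?c h * moment I V f (override_on w h S))
      = (\<Sum>h\<in>S \<rightarrow>\<^sub>E {..r}. \<Sum>v\<in>V. f v * (?c h * of_nat (binomial_prod I v (override_on w h S))))"
    by (simp add: moment_def sum_distrib_left mult.left_commute)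
  also have "\<dots> = (\<Sum>v\<in>V. f v
      * (\<Sum>h\<in>S \<rightarrow>\<^sub>E {..r}. ?c h * of_nat (binomial_prod I v (override_on w h S))))"
    unfolding sum_distrib_left by (rule sum.swap)
  also have "\<dots> = 0" by (simp add: vanish)
  finally show ?thesis .
qed

lemma moment_eq_0_if_missing_pattern:
  fixes f :: "('a \<Rightarrow> nat) \<Rightarrow> 'k::{idom, ring_char_0}"
  assumes "finite I" "V \<subseteq> I \<rightarrow>\<^sub>E {..r}" "S \<subseteq> level I r w"
    and pattern_le: "\<And>j. j \<in> S \<Longrightarrow> a j \<le> r"
    and missing: "\<And>v. v \<in> V \<Longrightarrow> \<exists>j\<in>S. v j \<noteq> a j"
    and smaller: "\<And>y. level I r y \<subset> level I r w \<Longrightarrow> moment I V f y = 0"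
  shows "moment I V f w = 0"
proof -
  let ?H = "S \<rightarrow>\<^sub>E {..r}"
  let ?c = "\<lambda>h. \<Prod>j\<in>S. indicator_coeff (a j) (h j) :: 'k"
  define top where "top = (\<lambda>j\<in>S. r)"
  have "S \<subseteq> I" using assms(3) by (auto simp: level_def)
  then have "finite S" using assms(1) finite_subset by blast
  have top_in: "top \<in> ?H" by (auto simp: top_def)
  have zero: "moment I V f (override_on w h S) = 0" if "h \<in> ?H - {top}" for h
  proof (rule smaller)
    have "h \<in> ?H" "h \<noteq> top" using that by auto
    then obtain j where "j \<in> S" "h j \<noteq> top j" using top_in by (meson PiE_ext)
    then have "j \<in> level I r w" "j \<notin> level I r (override_on w h S)"
      using assms(3) by (auto simp: level_def top_def)
    moreover have "level I r (override_on w h S) \<subseteq> level I r w"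
      using assms(3) by (auto simp: level_def override_on_def)
    ultimately show "level I r (override_on w h S) \<subset> level I r w" by blast
  qed
  have "0 = (\<Sum>h\<in>?H. ?c h * moment I V f (override_on w h S))"
    using sum_indicator_coeff_moment_eq_0[OF assms(1,2) \<open>S \<subseteq> I\<close> missing] by simp
  also have "\<dots> = ?c top * moment I V f (override_on w top S)"
    using \<open>finite S\<close> zero by (simp add: sum.remove[OF _ top_in] finite_PiE)
  also have "override_on w top S = w"
    using assms(3) by (auto simp: fun_eq_iff override_on_def top_def level_def)
  finally have "?c top * moment I V f w = 0" by simp
  moreover have "?c top \<noteq> 0"
    using \<open>finite S\<close> pattern_le by (simp add: indicator_coeff_eq_0_iff top_def not_less)
  ultimately show ?thesis by simp
qed

lemma not_shatters_imp_missing_pattern: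
  assumes "V \<subseteq> I \<rightarrow>\<^sub>E {..r}" "S \<subseteq> I" "\<not> shatters (Suc r) V S"
  obtains a where "\<And>j. j \<in> S \<Longrightarrow> a j \<le> r" "\<And>v. v \<in> V \<Longrightarrow> \<exists>j\<in>S. v j \<noteq> a j"
proof -
  have "(\<lambda>v. restrict v S) ` V \<subseteq> S \<rightarrow>\<^sub>E {0..<Suc r}"
    using assms(1,2) by (fastforce simp: less_Suc_eq_le)
  then obtain a where a: "a \<in> S \<rightarrow>\<^sub>E {0..<Suc r}" "a \<notin> (\<lambda>v. restrict v S) ` V"
    using assms(3) unfolding shatters_def by blast
  have "\<exists>j\<in>S. v j \<noteq> a j" if "v \<in> V" for v
    using a that by (metis PiE_restrict image_eqI restrict_ext)
  moreover have "a j \<le> r" if "j \<in> S" for j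
    using PiE_mem[OF a(1) that] by simp
  ultimately show ?thesis by (intro that)
qed

lemma moment_eq_0_if_not_shatters:
  fixes f :: "(nat \<Rightarrow> nat) \<Rightarrow> 'k::{idom, ring_char_0}"
  assumes "finite I" "V \<subseteq> I \<rightarrow>\<^sub>E {..r}"
    and not_shatters: "\<And>S. S \<subseteq> I \<Longrightarrow> card S = s + 1 \<Longrightarrow> \<not> shatters (Suc r) V S"
    and small: "\<And>w. card (level I r w) \<le> s \<Longrightarrow> moment I V f w = 0"
  shows "moment I V f w = 0"
proof (induction "card (level I r w)" arbitrary: w rule: less_induct)
  case less
  show ?case
  proof (cases "card (level I r w) \<le> s")
    case True
    then show ?thesis by (rule small)
  next
    case False
    then obtain S where S: "S \<subseteq> level I r w" "card S = s + 1"
      by (metis Suc_eq_plus1 not_less_eq_eq obtain_subset_with_card_n)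
    have "S \<subseteq> I" using S(1) by (auto simp: level_def)
    then obtain a where pattern: "\<And>j. j \<in> S \<Longrightarrow> a j \<le> r" "\<And>v. v \<in> V \<Longrightarrow> \<exists>j\<in>S. v j \<noteq> a j"
      using not_shatters_imp_missing_pattern[OF assms(2) _ not_shatters[OF _ S(2)]] by metis
    have "finite (level I r w)" using assms(1) by (simp add: level_def)
    then have smaller: "moment I V f y = 0" if "level I r y \<subset> level I r w" for y
      using that by (intro less psubset_card_mono)
    show ?thesis by (rule moment_eq_0_if_missing_pattern[OF assms(1,2) S(1) pattern smaller])
  qed
qed

section \<open>The bound\<close>

definition ballot_tuples :: "nat \<Rightarrow> nat \<Rightarrow> nat \<Rightarrow> (nat \<Rightarrow> nat) set" where
  "ballot_tuples n r s =
    {w \<in> {1..n} \<rightarrow>\<^sub>E {..r}. ballot n (level {1..n} r w) \<and> card (level {1..n} r w) \<le> s}"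

lemma finite_ballot_tuples: "finite (ballot_tuples n r s)"
  by (rule finite_subset[of _ "{1..n} \<rightarrow>\<^sub>E {..r}"]) (auto simp: ballot_tuples_def intro: finite_PiE)

lemma card_tuples_with_level:
  assumes "finite I" "T \<subseteq> I"
  shows "card {w \<in> I \<rightarrow>\<^sub>E {..r}. level I r w = T} = r ^ (card I - card T)"
proof -
  have level_iff: "level I r w = T \<longleftrightarrow> (\<forall>j\<in>I. w j = r \<longleftrightarrow> j \<in> T)" for w
    using assms(2) by (auto simp: level_def)
  have coordinate_iff: "w j \<in> (if j \<in> T then {r} else {..<r}) \<longleftrightarrow> w j \<le> r \<and> (w j = r \<longleftrightarrow> j \<in> T)"
    for w j
    by auto
  have "{w \<in> I \<rightarrow>\<^sub>E {..r}. level I r w = T} = (\<Pi>\<^sub>E j\<in>I. if j \<in> T then {r} else {..<r})"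
    by (intro set_eqI) (simp only: PiE_iff level_iff coordinate_iff mem_Collect_eq atMost_iff
        ball_conj_distrib conj_ac)
  then have "card {w \<in> I \<rightarrow>\<^sub>E {..r}. level I r w = T} = (\<Prod>j\<in>I. if j \<in> T then 1 else r)"
    using assms(1) by (simp add: card_PiE if_distrib cong: if_cong)
  also have "\<dots> = (\<Prod>j\<in>I - T. r)"
    using assms by (intro prod.mono_neutral_cong_right) auto
  also have "\<dots> = r ^ (card I - card T)"
    using assms by (simp add: card_Diff_subset finite_subset)
  finally show ?thesis .
qed

lemma card_ballot_tuples:
  assumes "2 * s \<le> n"
  shows "int (card (ballot_tuples n r s))
    = (\<Sum>i=0..s. int r ^ (n - i) * (binom n (int i) - binom n (int i - 1)))"
proof -
  define tuples_over where "tuples_over T = {w \<in> {1..n} \<rightarrow>\<^sub>E {..r}. level {1..n} r w = T}"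
    for T
  have finite_tuples_over: "finite (tuples_over T)" for T
    by (rule finite_subset[of _ "{1..n} \<rightarrow>\<^sub>E {..r}"]) (auto simp: tuples_over_def intro: finite_PiE)
  have "card (ballot_tuples n r s) = card (\<Union>T\<in>(\<Union>i\<in>{0..s}. ballot_sets n i). tuples_over T)"
    by (rule arg_cong[of _ _ card]) (auto simp: ballot_tuples_def tuples_over_def ballot_sets_def)
  also have "\<dots> = (\<Sum>T\<in>(\<Union>i\<in>{0..s}. ballot_sets n i). card (tuples_over T))"
    using finite_tuples_over
    by (intro card_UN_disjoint) (auto simp: finite_ballot_sets tuples_over_def)
  also have "\<dots> = (\<Sum>i=0..s. \<Sum>T\<in>ballot_sets n i. card (tuples_over T))"
    using finite_ballot_sets by (intro sum.UNION_disjoint) (auto simp: ballot_sets_def)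
  also have "\<dots> = (\<Sum>i=0..s. r ^ (n - i) * card (ballot_sets n i))"
  proof (intro sum.cong refl)
    fix i
    have "card (tuples_over T) = r ^ (n - i)" if "T \<in> ballot_sets n i" for T
      using that card_tuples_with_level[of "{1..n}" T r]
      by (simp add: tuples_over_def ballot_sets_def ballot_def)
    then show "(\<Sum>T\<in>ballot_sets n i. card (tuples_over T)) = r ^ (n - i) * card (ballot_sets n i)"
      by simp
  qed
  finally show ?thesis using assms by (simp add: card_ballot_sets)
qed

lemma moment_eq_0_if_ballot_tuples_moments_eq_0:
  fixes f :: "(nat \<Rightarrow> nat) \<Rightarrow> 'k::{idom, ring_char_0}"
  assumes V: "V \<subseteq> {1..n} \<rightarrow>\<^sub>E {..r}" "\<And>v. v \<in> V \<Longrightarrow> sum v {1..n} = d" and "r \<ge> 1"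
    and not_shatters: "\<And>S. S \<subseteq> {1..n} \<Longrightarrow> card S = s + 1 \<Longrightarrow> \<not> shatters (Suc r) V S"
    and ballot: "\<And>w. w \<in> ballot_tuples n r s \<Longrightarrow> moment {1..n} V f w = 0"
  shows "moment {1..n} V f w = 0"
proof (rule moment_eq_0_if_not_shatters[OF _ V(1) not_shatters])
  show "moment {1..n} V f w = 0" if "card (level {1..n} r w) \<le> s" for w
  proof (rule moment_eq_0_if_ballot_moments_eq_0[OF V(2) \<open>r \<ge> 1\<close> _ that])
    fix w assume w: "card (level {1..n} r w) \<le> s" "ballot n (level {1..n} r w)"
    show "moment {1..n} V f w = 0"
    proof (cases "\<forall>j\<in>{1..n}. w j \<le> r")
      case True
      have "level {1..n} r (restrict w {1..n}) = level {1..n} r w" by (auto simp: level_def)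
      then have "restrict w {1..n} \<in> ballot_tuples n r s"
        using w True by (auto simp: ballot_tuples_def)
      then show ?thesis using ballot moment_restrict by metis
    next
      case False
      then obtain j where "j \<in> {1..n}" "r < w j" by (auto simp: not_le)
      then show ?thesis by (intro moment_eq_0_if_exceeds[OF _ V(1)]) auto
    qed
  qed
qed auto

theorem theorem4:
  fixes n q d s :: nat and V :: "(nat \<Rightarrow> nat) set"
  assumes "n \<ge> 1" and "q \<ge> 2"
    and "d \<le> n * (q - 1)"
    and "real s \<le> real n / 2"
    and "tuple_system n q V"
    and "uniform_system n d V"
    and "\<And>S. S \<subseteq> {1..n} \<Longrightarrow> card S = s + 1 \<Longrightarrow> \<not> shatters q V S"
  shows "int (card V) \<le>
    (\<Sum>i=0..s. (int q - 1) ^ (n - i) * (binom n (int i) - binom n (int i - 1)))"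
proof -
  obtain r where q: "q = Suc r" "r \<ge> 1" using assms(2) by (cases q) auto
  have V: "V \<subseteq> {1..n} \<rightarrow>\<^sub>E {..r}"
    using assms(5) by (simp add: tuple_system_def q atLeast0LessThan lessThan_Suc_atMost)
  have uniform: "\<And>v. v \<in> V \<Longrightarrow> sum v {1..n} = d"
    using assms(6) by (simp add: uniform_system_def)
  have "finite V" using V by (rule finite_subset) (simp add: finite_PiE)
  have "card V \<le> card (ballot_tuples n r s)"
  proof (rule ccontr)
    assume "\<not> card V \<le> card (ballot_tuples n r s)"
    then obtain f :: "_ \<Rightarrow> real" where f: "\<exists>v\<in>V. f v \<noteq> 0"
      "\<forall>w\<in>ballot_tuples n r s. moment {1..n} V f w = 0"
      using homogeneous_system_nontrivial_solution[OF finite_ballot_tuples \<open>finite V\<close>,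
          of n r s "\<lambda>w v. real (binomial_prod {1..n} v w)"]
      unfolding moment_def not_le by metis
    have "moment {1..n} V f v = 0" for v
      using V uniform q(2) assms(7)[unfolded q(1)] bspec[OF f(2)]
      by (rule moment_eq_0_if_ballot_tuples_moments_eq_0)
    moreover have "moment {1..n} V f v = f v" if "v \<in> V" for v
      using V \<open>finite V\<close> uniform that by (intro moment_self) (auto simp: PiE_def)
    ultimately show False using f(1) by simp
  qed
  then show ?thesis using card_ballot_tuples[of s n r] assms(4) q(1) by simp
qed

end
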